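(* Let $Q$ be an infinite-dimensional real Banach space and let $K_0,K_1\subset Q$ be compact sets. Then for almost every $\boldsymbol{y}\in Q$ there exists a continuous linear functional $\boldsymbol{l}\in Q^*$ such that $$\boldsymbol{l}(\boldsymbol{x}_1-\boldsymbol{x}_0)>0\quad\text{for all }\boldsymbol{x}_0\in K_0,\ \boldsymbol{x}_1\in K_1+\boldsymbol{y}.$$ Here "for almost every $\boldsymbol{y}$" means that the set of those $\boldsymbol{y}\in Q$ for which no such $\boldsymbol{l}$ exists is completely thin.
   Context: $K_1+\boldsymbol{y}=\{\boldsymbol{u}+\boldsymbol{y} : \boldsymbol{u}\in K_1\}$. A set $Y\subset Q$ is completely thin if for every compact space $K$ the set of continuous maps $\Psi:K\to Q$ with $\Psi(K)\cap Y\ne\emptyset$ is a set of first Baire category in the Banach space $C(K,Q)$ of continuous maps $K\to Q$ equipped with the maximum norm. *)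

theory Defs
  imports "HOL-Analysis.Analysis"
begin

definition nowhere_dense_in :: "'a topology \<Rightarrow> 'a set \<Rightarrow> bool" where
  "nowhere_dense_in X N \<longleftrightarrow> N \<subseteq> topspace X \<and> X interior_of (X closure_of N) = {}"

definition first_category_in :: "'a topology \<Rightarrow> 'a set \<Rightarrow> bool" where
  "first_category_in X A \<longleftrightarrow>
     (\<exists>\<N>. countable \<N> \<and> (\<forall>N\<in>\<N>. nowhere_dense_in X N) \<and> A = \<Union>\<N>)"

(* For compact K, cfunspace K euclidean_metric is the space C(K,Q) with the metric of the
   maximum norm: its points are the continuous maps K -> Q (boundedness is automatic),
   represented by functions that are undefined outside topspace K. *)
abbreviation C_space :: "'k topology \<Rightarrow> ('k \<Rightarrow> 'q::real_normed_vector) metric" where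
  "C_space K \<equiv> cfunspace K euclidean_metric"

(* A formula of HOL cannot quantify over types, so the type 'k from which the compact spaces
   take their points is a parameter. A theorem in which 'k is a free type variable holds at
   every instance of 'k, hence for all compact spaces. *)
definition completely_thin :: "'k itself \<Rightarrow> 'q::banach set \<Rightarrow> bool" where
  "completely_thin (_ :: 'k itself) Y \<longleftrightarrow>
     (\<forall>K :: 'k topology. compact_space K \<longrightarrow>
        first_category_in (mtopology_of (C_space K))
          {\<Psi> \<in> mspace (C_space K). \<Psi> ` topspace K \<inter> Y \<noteq> {}})"

end

theory Submission
  imports Defs
begin

text \<open>
  A functional \<open>l\<close> as required exists if and only if \<open>0\<close> can be strictly separated from
  \<open>K\<^sub>1 + y - K\<^sub>0\<close>, so by Hahn--Banach the exceptional set lies in the negative of the closed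
  convex hull \<open>C\<close> of \<open>K\<^sub>1 - K\<^sub>0\<close>, which is compact by Mazur's theorem. If \<open>\<Phi> : K \<rightarrow> Q\<close> is
  continuous, then \<open>-C - \<Phi>(K)\<close> is compact and hence has empty interior in the
  infinite-dimensional space \<open>Q\<close>; so an arbitrarily small translation moves \<open>\<Phi>(K)\<close> off \<open>-C\<close>,
  and it stays off under small perturbations.
\<close>

section \<open>Hahn--Banach separation\<close>

definition sublinear :: "('a::real_vector \<Rightarrow> real) \<Rightarrow> bool" where
  "sublinear p \<longleftrightarrow> (\<forall>x y. p (x + y) \<le> p x + p y) \<and> (\<forall>t x. 0 \<le> t \<longrightarrow> p (t *\<^sub>R x) = t * p x)"

lemma sublinear_add: "sublinear p \<Longrightarrow> p (x + y) \<le> p x + p y"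
  and sublinear_scale: "sublinear p \<Longrightarrow> 0 \<le> t \<Longrightarrow> p (t *\<^sub>R x) = t * p x"
  by (auto simp: sublinear_def)

lemma sublinear_zero: "sublinear p \<Longrightarrow> p 0 = 0"
  using sublinear_scale[of p 0 0] by simp

lemma sublinear_minus: "sublinear p \<Longrightarrow> - p (- x) \<le> p x"
  using sublinear_add[of p x "- x"] sublinear_zero[of p] by simp

text \<open>One inequality suffices for positive homogeneity: applied with \<open>1 / t\<close> to
  \<open>t *\<^sub>R x\<close>, it yields the reverse one.\<close>

lemma sublinearI:
  assumes add: "\<And>x y. p (x + y) \<le> p x + p y"
    and scale: "\<And>t x. 0 < t \<Longrightarrow> p (t *\<^sub>R x) \<le> t * p x"
    and zero: "p 0 = 0"
  shows "sublinear p"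
  unfolding sublinear_def
proof (intro conjI allI impI)
  fix t :: real and x
  assume "0 \<le> t"
  show "p (t *\<^sub>R x) = t * p x"
  proof (cases "t = 0")
    case True
    then show ?thesis by (simp add: zero)
  next
    case False
    with \<open>0 \<le> t\<close> have t: "t > 0" by simp
    have "p ((1 / t) *\<^sub>R (t *\<^sub>R x)) \<le> 1 / t * p (t *\<^sub>R x)"
      using t by (intro scale) simp
    then have "t * p x \<le> p (t *\<^sub>R x)"
      using t by (simp add: field_simps)
    with scale[OF t, of x] show ?thesis by simp
  qed
qed (rule add)

text \<open>
  Used with a singleton \<open>C\<close> to show that minimal sublinear functionals are linear, and with
  \<open>p = norm\<close> for the separation theorem.
\<close>

lemma sublinear_refine_convex:
  fixes p :: "'a::real_vector \<Rightarrow> real"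
  assumes p: "sublinear p" and "convex C" and "C \<noteq> {}" and d: "\<And>c. c \<in> C \<Longrightarrow> d \<le> p c"
  shows "\<exists>q. sublinear q \<and> (\<forall>x. q x \<le> p x) \<and> (\<forall>c\<in>C. q (- c) \<le> - d)"
proof -
  \<comment> \<open>\<open>q\<close> is the largest sublinear functional below \<open>p\<close> with
    \<open>q (- c) \<le> - d\<close> on \<open>C\<close>: any such \<open>r\<close> satisfies
    \<open>r x \<le> r (x + t *\<^sub>R c) + t * r (- c)\<close>, which is at most
    \<open>p (x + t *\<^sub>R c) - t * d\<close>.\<close>
  define V where "V x = {p (x + t *\<^sub>R c) - t * d | t c. 0 \<le> t \<and> c \<in> C}" for x
  define q where "q x = Inf (V x)" for x
  have V: "V x \<noteq> {}" for x
    using \<open>C \<noteq> {}\<close> unfolding V_def by (auto intro: exI[of _ 0])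
  \<comment> \<open>The hypothesis \<open>d \<le> p c\<close> enters here; it keeps the infimum
    finite.\<close>
  have lower: "- p (- x) \<le> v" if "v \<in> V x" for v x
  proof -
    from that obtain t c where tc: "0 \<le> t" "c \<in> C" "v = p (x + t *\<^sub>R c) - t * d"
      by (auto simp: V_def)
    have "t * d \<le> t * p c"
      using tc d by (intro mult_left_mono) auto
    also have "\<dots> = p ((x + t *\<^sub>R c) + - x)"
      using sublinear_scale[OF p tc(1)] by simp
    also have "\<dots> \<le> p (x + t *\<^sub>R c) + p (- x)"
      by (rule sublinear_add[OF p])
    finally show ?thesis using tc(3) by simp
  qed
  have bdd: "bdd_below (V x)" for x
    using lower by (rule bdd_belowI)
  have q_le: "q x \<le> p (x + t *\<^sub>R c) - t * d" if "0 \<le> t" "c \<in> C" for x t c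
    unfolding q_def by (rule cInf_lower[OF _ bdd]) (use that in \<open>auto simp: V_def\<close>)
  have q_ge: "b \<le> q x" if "\<And>t c. 0 \<le> t \<Longrightarrow> c \<in> C \<Longrightarrow> b \<le> p (x + t *\<^sub>R c) - t * d" for b x
    unfolding q_def by (rule cInf_greatest[OF V]) (use that in \<open>auto simp: V_def\<close>)
  obtain c\<^sub>0 where c\<^sub>0: "c\<^sub>0 \<in> C" using \<open>C \<noteq> {}\<close> by blast
  have q_p: "q x \<le> p x" for x
    using q_le[OF order_refl c\<^sub>0, of x] by simp
  \<comment> \<open>Convexity makes the cone over \<open>C\<close> closed under addition with the
    weights adding up, so the penalties \<open>t * d\<close> and \<open>s * d\<close> combine
    exactly. This gives subadditivity of \<open>q\<close>.\<close>
  have cone: "\<exists>c\<in>C. t *\<^sub>R a + s *\<^sub>R b = (t + s) *\<^sub>R c"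
    if "0 \<le> t" "0 \<le> s" "a \<in> C" "b \<in> C" for t s a b
  proof (cases "t + s = 0")
    case True
    with that show ?thesis by (intro bexI[of _ a]) (auto simp: add_nonneg_eq_0_iff)
  next
    case False
    with that have "t + s > 0" by simp
    then have "(t / (t + s)) *\<^sub>R a + (s / (t + s)) *\<^sub>R b \<in> C"
      using that by (intro convexD[OF \<open>convex C\<close>]) (auto simp: add_divide_distrib[symmetric])
    then show ?thesis
      using False by (intro bexI) (auto simp: scaleR_add_right)
  qed
  have "sublinear q"
  proof (rule sublinearI)
    fix x y
    \<comment> \<open>The two infima are taken one after the other: first \<open>t\<close>,
      \<open>a\<close> are fixed, then \<open>s\<close>, \<open>b\<close>.\<close>
    have "q (x + y) - q y \<le> q x"
    proof (rule q_ge)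
      fix t a assume ta: "0 \<le> (t::real)" "a \<in> C"
      have "q (x + y) - (p (x + t *\<^sub>R a) - t * d) \<le> q y"
      proof (rule q_ge)
        fix s b assume sb: "0 \<le> (s::real)" "b \<in> C"
        obtain c where c: "c \<in> C" "t *\<^sub>R a + s *\<^sub>R b = (t + s) *\<^sub>R c"
          using cone ta sb by blast
        have "q (x + y) \<le> p ((x + y) + (t + s) *\<^sub>R c) - (t + s) * d"
          using ta sb c by (intro q_le) auto
        also have "(x + y) + (t + s) *\<^sub>R c = (x + t *\<^sub>R a) + (y + s *\<^sub>R b)"
          by (simp add: c(2)[symmetric])
        also have "p \<dots> \<le> p (x + t *\<^sub>R a) + p (y + s *\<^sub>R b)"
          by (rule sublinear_add[OF p])
        finally show "q (x + y) - (p (x + t *\<^sub>R a) - t * d) \<le> p (y + s *\<^sub>R b) - s * d"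
          by (simp add: algebra_simps)
      qed
      then show "q (x + y) - q y \<le> p (x + t *\<^sub>R a) - t * d" by simp
    qed
    then show "q (x + y) \<le> q x + q y" by simp
  next
    fix t :: real and x assume t: "0 < t"
    have "q (t *\<^sub>R x) / t \<le> q x"
    proof (rule q_ge)
      fix s c assume sc: "0 \<le> (s::real)" "c \<in> C"
      have "q (t *\<^sub>R x) \<le> p (t *\<^sub>R x + (t * s) *\<^sub>R c) - (t * s) * d"
        using t sc by (intro q_le) auto
      also have "t *\<^sub>R x + (t * s) *\<^sub>R c = t *\<^sub>R (x + s *\<^sub>R c)"
        by (simp add: scaleR_add_right)
      also have "p \<dots> = t * p (x + s *\<^sub>R c)"
        using sublinear_scale[OF p] t by simp
      finally show "q (t *\<^sub>R x) / t \<le> p (x + s *\<^sub>R c) - s * d"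
        using t by (simp add: field_simps)
    qed
    then show "q (t *\<^sub>R x) \<le> t * q x"
      using t by (simp add: field_simps)
  next
    have "0 \<le> q 0"
      using lower[of _ 0] sublinear_zero[OF p] V
      unfolding q_def by (intro cInf_greatest) auto
    then show "q 0 = 0"
      using q_p[of 0] sublinear_zero[OF p] by simp
  qed
  moreover have "q (- c) \<le> - d" if "c \<in> C" for c
    using q_le[of 1 c "- c"] that sublinear_zero[OF p] by simp
  ultimately show ?thesis using q_p by blast
qed

text \<open>Supplies the lower bounds for Zorn's lemma. The pointwise infimum is finite because
  \<open>- p (- x) \<le> - q (- x) \<le> q x\<close>, and it is subadditive because of any two
  members of a chain one lies below both.\<close>

lemma sublinear_Inf_chain:
  assumes ne: "D \<noteq> {}" and sub: "\<And>q. q \<in> D \<Longrightarrow> sublinear q" and le: "\<And>q x. q \<in> D \<Longrightarrow> q x \<le> p x"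
    and chain: "\<And>q r. q \<in> D \<Longrightarrow> r \<in> D \<Longrightarrow> q \<le> r \<or> r \<le> q"
  obtains u where "sublinear u" "\<And>q x. q \<in> D \<Longrightarrow> u x \<le> q x"
proof -
  define u where "u x = (INF q\<in>D. q x)" for x
  have bdd: "bdd_below ((\<lambda>q. q x) ` D)" for x
  proof (rule bdd_belowI2)
    fix q assume "q \<in> D"
    then show "- p (- x) \<le> q x"
      using sublinear_minus[OF sub, of q x] le[of q "- x"] by linarith
  qed
  have u_le: "u x \<le> q x" if "q \<in> D" for q x
    unfolding u_def by (rule cINF_lower[OF bdd that])
  have u_ge: "b \<le> u x" if "\<And>q. q \<in> D \<Longrightarrow> b \<le> q x" for b x
    unfolding u_def by (rule cINF_greatest[OF ne that])
  have "sublinear u"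
  proof (rule sublinearI)
    fix x y
    have "u (x + y) - u y \<le> u x"
    proof (rule u_ge)
      fix q assume q: "q \<in> D"
      have "u (x + y) - q x \<le> u y"
      proof (rule u_ge)
        fix r assume r: "r \<in> D"
        obtain m where "m \<in> D" "m \<le> q" "m \<le> r"
          using chain[OF q r] q r by blast
        then show "u (x + y) - q x \<le> r y"
          using u_le[of m "x + y"] sublinear_add[OF sub, of m x y] le_funD[of m q x] le_funD[of m r y]
          by linarith
      qed
      then show "u (x + y) - u y \<le> q x" by simp
    qed
    then show "u (x + y) \<le> u x + u y" by simp
  next
    fix t :: real and x assume t: "0 < t"
    have "u (t *\<^sub>R x) / t \<le> u x"
    proof (rule u_ge)
      fix q assume q: "q \<in> D"
      show "u (t *\<^sub>R x) / t \<le> q x"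
        using u_le[OF q, of "t *\<^sub>R x"] sublinear_scale[OF sub[OF q], of t x] t
        by (simp add: field_simps)
    qed
    then show "u (t *\<^sub>R x) \<le> t * u x"
      using t by (simp add: field_simps)
  next
    show "u 0 = 0"
      using ne sub by (simp add: u_def sublinear_zero)
  qed
  with u_le that show thesis by blast
qed

text \<open>A minimal sublinear functional below \<open>p\<close> is linear: minimality makes it
  odd, and an odd subadditive function is additive.\<close>

theorem Hahn_Banach_sublinear:
  fixes p :: "'a::real_vector \<Rightarrow> real"
  assumes p: "sublinear p"
  shows "\<exists>f. linear f \<and> (\<forall>x. f x \<le> p x)"
proof -
  define A where "A = {q. sublinear q \<and> q \<le> p}"
  have "\<exists>m\<in>A. \<forall>a\<in>A. a \<le> m \<longrightarrow> a = m"
  proof (rule predicate_Zorn)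
    \<comment> \<open>The order is reversed, so that the maximal element from Zorn's lemma is a
      minimal functional.\<close>
    show "partial_order_on A (relation_of (\<lambda>x y. y \<le> x) A)"
      by (rule partial_order_on_relation_ofI) auto
  next
    fix D assume D: "D \<in> Chains (relation_of (\<lambda>x y. y \<le> x) A)"
    show "\<exists>u\<in>A. \<forall>a\<in>D. u \<le> a"
    proof (cases "D = {}")
      case True
      then show ?thesis using p by (auto simp: A_def)
    next
      case False
      have DA: "D \<subseteq> A" and chain: "\<And>q r. q \<in> D \<Longrightarrow> r \<in> D \<Longrightarrow> q \<le> r \<or> r \<le> q"
        using D by (auto simp: Chains_def relation_of_def)
      obtain u where u: "sublinear u" "\<And>q x. q \<in> D \<Longrightarrow> u x \<le> q x"
        using sublinear_Inf_chain[OF False _ _ chain, of p] DA by (auto simp: A_def le_fun_def)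
      then have "\<forall>a\<in>D. u \<le> a" by (simp add: le_fun_def)
      moreover have "u \<in> A"
      proof -
        obtain q where "q \<in> D" using False by blast
        then have "u \<le> q" "q \<le> p" using \<open>\<forall>a\<in>D. u \<le> a\<close> DA by (auto simp: A_def)
        then have "u \<le> p" by (rule order_trans)
        with u(1) show ?thesis by (simp add: A_def)
      qed
      ultimately show ?thesis by blast
    qed
  qed
  then obtain f where "f \<in> A" and f_min: "\<And>q. q \<in> A \<Longrightarrow> q \<le> f \<Longrightarrow> q = f" by blast
  then have f: "sublinear f" "f \<le> p" by (simp_all add: A_def)
  have min: "q = f" if "sublinear q" "q \<le> f" for q
    using f_min[of q] that order_trans[OF that(2) f(2)] by (simp add: A_def)
  have minus: "f (- a) = - f a" for a
  proof -
    \<comment> \<open>The refinement along the single point \<open>a\<close> with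
      \<open>d = f a\<close> lies below \<open>f\<close>, hence equals \<open>f\<close> and passes
      its bound at \<open>- a\<close> on to \<open>f\<close>.\<close>
    obtain q where "sublinear q" "\<forall>x. q x \<le> f x" "q (- a) \<le> - f a"
      using sublinear_refine_convex[OF f(1), of "{a}" "f a"] by auto
    with min[of q] have "f (- a) \<le> - f a" by (auto simp: le_fun_def)
    with sublinear_minus[OF f(1), of a] show ?thesis by linarith
  qed
  have "linear f"
  proof (rule linearI)
    fix x y
    have "f ((- x) + (- y)) \<le> f (- x) + f (- y)"
      by (rule sublinear_add[OF f(1)])
    then have "- f (x + y) \<le> - f x - f y"
      using minus[of "x + y"] by (simp add: minus)
    with sublinear_add[OF f(1), of x y] show "f (x + y) = f x + f y" by linarith
  next
    fix t :: real and x
    show "f (t *\<^sub>R x) = t *\<^sub>R f x"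
    proof (cases "0 \<le> t")
      case True
      then show ?thesis by (simp add: sublinear_scale[OF f(1)])
    next
      case False
      then show ?thesis
        using sublinear_scale[OF f(1), of "- t" x] minus[of "t *\<^sub>R x"] by simp
    qed
  qed
  with f(2) show ?thesis by (auto simp: le_fun_def)
qed

text \<open>Since \<open>C\<close> misses a ball of radius \<open>d\<close> about \<open>0\<close>,
  the norm is at least \<open>d\<close> on \<open>C\<close> and can be refined to \<open>q\<close>.
  A linear \<open>f\<close> below \<open>q\<close> is bounded by the norm, hence continuous, and
  \<open>f c = - f (- c) \<ge> d\<close>.\<close>

theorem separation_closed_convex_zero:
  fixes C :: "'a::real_normed_vector set"
  assumes "convex C" "closed C" "0 \<notin> C"
  obtains l :: "'a \<Rightarrow>\<^sub>L real" where "\<And>c. c \<in> C \<Longrightarrow> blinfun_apply l c > 0"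
proof (cases "C = {}")
  case True
  then show thesis using that[of 0] by simp
next
  case False
  have "open (- C)" "0 \<in> - C" using assms by auto
  then obtain d where d: "d > 0" "ball 0 d \<subseteq> - C"
    by (meson open_contains_ball)
  have norm: "d \<le> norm c" if "c \<in> C" for c
    using d(2) that by (force simp: subset_iff)
  have sub: "sublinear (norm :: 'a \<Rightarrow> real)"
    by (auto simp: sublinear_def norm_triangle_ineq)
  obtain q where q: "sublinear q" "\<And>x::'a. q x \<le> norm x" "\<And>c. c \<in> C \<Longrightarrow> q (- c) \<le> - d"
    using sublinear_refine_convex[OF sub assms(1) False norm] by blast
  obtain f where f: "linear f" "\<And>x. f x \<le> q x"
    using Hahn_Banach_sublinear[OF q(1)] by blast
  have "bounded_linear f"
    unfolding bounded_linear_def bounded_linear_axioms_def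
  proof (intro conjI exI allI)
    fix x
    show "norm (f x) \<le> norm x * 1"
      using f(2)[of x] f(2)[of "- x"] q(2)[of x] q(2)[of "- x"] linear_neg[OF f(1), of x]
        norm_minus_cancel[of x]
      unfolding real_norm_def by linarith
  qed (rule f(1))
  moreover have "f c > 0" if "c \<in> C" for c
    using f(2)[of "- c"] q(3)[OF that] linear_neg[OF f(1), of c] d(1) by linarith
  ultimately show thesis
    by (intro that[of "Blinfun f"]) (simp add: bounded_linear_Blinfun_apply)
qed

section \<open>Compact sets in Banach spaces\<close>

text \<open>Total boundedness with three errors of \<open>e / 3\<close>: from the closure to the
  hull of \<open>D\<close>, from there to the hull of a finite net \<open>k\<close>, and from that
  compact hull to a finite net \<open>j\<close>.\<close>

theorem Mazur_compact_closure_convex_hull: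
  fixes D :: "'a::banach set"
  assumes "compact D"
  shows "compact (closure (convex hull D))"
  unfolding compact_eq_totally_bounded
proof (intro conjI allI impI)
  show "complete (closure (convex hull D))"
    by (simp add: complete_eq_closed)
next
  fix e :: real assume "e > 0"
  then have e: "e / 3 > 0" by simp
  obtain k where k: "finite k" "D \<subseteq> (\<Union>x\<in>k. ball x (e / 3))"
    using assms e unfolding compact_eq_totally_bounded by blast
  have "compact (convex hull k)"
    by (rule finite_imp_compact_convex_hull[OF k(1)])
  then obtain j where j: "finite j" "convex hull k \<subseteq> (\<Union>x\<in>j. ball x (e / 3))"
    using e unfolding compact_eq_totally_bounded by blast
  have "D \<subseteq> (\<Union>x\<in>convex hull k. \<Union>y\<in>ball 0 (e / 3). {x + y})"
  proof
    fix z assume "z \<in> D"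
    then obtain x where "x \<in> k" "z \<in> ball x (e / 3)" using k(2) by blast
    then have "x \<in> convex hull k" "z - x \<in> ball 0 (e / 3)" "z = x + (z - x)"
      by (auto simp: hull_inc dist_norm norm_minus_commute)
    then show "z \<in> (\<Union>x\<in>convex hull k. \<Union>y\<in>ball 0 (e / 3). {x + y})" by blast
  qed
  \<comment> \<open>A sum of convex sets is convex, so it contains the hull of \<open>D\<close> as
    soon as it contains \<open>D\<close>.\<close>
  then have hull: "convex hull D \<subseteq> (\<Union>x\<in>convex hull k. \<Union>y\<in>ball 0 (e / 3). {x + y})"
    by (rule hull_minimal) (intro convex_sums convex_convex_hull convex_ball)
  have "closure (convex hull D) \<subseteq> (\<Union>x\<in>j. ball x e)"
  proof
    fix z assume "z \<in> closure (convex hull D)"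
    then obtain w where w: "w \<in> convex hull D" "dist w z < e / 3"
      using e unfolding closure_approachable by blast
    then obtain x y where xy: "x \<in> convex hull k" "norm y < e / 3" "w = x + y"
      using hull by auto
    then obtain i where i: "i \<in> j" "dist i x < e / 3" using j(2) by auto
    have "dist x w < e / 3" using xy by (simp add: dist_norm)
    then have "dist i z < e"
      using i w dist_triangle[of i z x] dist_triangle[of x z w] by simp
    with i show "z \<in> (\<Union>x\<in>j. ball x e)" by auto
  qed
  with j(1) show "\<exists>k. finite k \<and> closure (convex hull D) \<subseteq> (\<Union>x\<in>k. ball x e)" by blast
qed

text \<open>A form of Riesz's theorem. Finitely many balls of radius \<open>1 / 2\<close> cover the
  unit ball; repeated approximation by their centres places the unit ball in the closed set
  \<open>?H\<close>, which lies in \<open>span F\<close>.\<close>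

lemma cball_subset_compact_imp_finite_span:
  fixes T :: "'a::real_normed_vector set"
  assumes "compact T" "cball 0 1 \<subseteq> T"
  obtains F where "finite F" "span F = (UNIV :: 'a set)"
proof -
  obtain F where F: "finite F" "T \<subseteq> (\<Union>x\<in>F. ball x (1 / 2))"
    using assms(1) unfolding compact_eq_totally_bounded
    by (meson half_gt_zero zero_less_one)
  let ?H = "(*\<^sub>R) 2 ` (convex hull F)"
  have H: "closed ?H"
    by (intro closed_scaling compact_imp_closed finite_imp_compact_convex_hull F(1))
  \<comment> \<open>The remainder \<open>x - f\<close> has norm at most \<open>1 / 2\<close>, so its
    double is again in the unit ball and the approximation can be repeated.\<close>
  have step: "\<exists>f\<in>F. norm (2 *\<^sub>R (x - f)) \<le> 1" if "norm x \<le> 1" for x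
  proof -
    have "x \<in> T" using that assms(2) by auto
    then obtain f where "f \<in> F" "dist f x < 1 / 2" using F(2) by auto
    then show ?thesis by (intro bexI[of _ f]) (auto simp: dist_norm norm_minus_commute)
  qed
  obtain f\<^sub>0 where f\<^sub>0: "f\<^sub>0 \<in> F" using step[of 0] by auto
  \<comment> \<open>Bounds \<open>norm (x - 2 *\<^sub>R f\<^sub>0)\<close> on the unit ball, which
    is the case \<open>n = 0\<close> below.\<close>
  define M where "M = 1 + 2 * norm f\<^sub>0"
  text \<open>The expansion \<open>x = f\<^sub>1 + f\<^sub>2 / 2 + f\<^sub>3 / 4 + \<dots>\<close> with \<open>f\<^sub>i \<in> F\<close> stays in twice the convex hull.\<close>
  have approx: "\<exists>z\<in>convex hull F. norm (x - 2 *\<^sub>R z) \<le> M / 2 ^ n" if "norm x \<le> 1" for x n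
    using that
  proof (induction n arbitrary: x)
    case 0
    have "norm (x - 2 *\<^sub>R f\<^sub>0) \<le> M"
      using norm_triangle_ineq4[of x "2 *\<^sub>R f\<^sub>0"] 0 by (simp add: M_def)
    then show ?case using f\<^sub>0 hull_inc[of f\<^sub>0 F] by auto
  next
    case (Suc n)
    obtain f where f: "f \<in> F" "norm (2 *\<^sub>R (x - f)) \<le> 1" using step Suc.prems by blast
    obtain z where z: "z \<in> convex hull F" "norm (2 *\<^sub>R (x - f) - 2 *\<^sub>R z) \<le> M / 2 ^ n"
      using Suc.IH[OF f(2)] by blast
    \<comment> \<open>If \<open>2 *\<^sub>R z\<close> approximates
      \<open>2 *\<^sub>R (x - f)\<close>, then \<open>f + z = 2 *\<^sub>R ?w\<close> approximates
      \<open>x\<close> with half the error.\<close>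
    let ?w = "(1 / 2) *\<^sub>R f + (1 / 2) *\<^sub>R z"
    have w: "?w \<in> convex hull F"
      using f z by (intro convexD[OF convex_convex_hull]) (auto simp: hull_inc)
    have "2 *\<^sub>R (x - f) - 2 *\<^sub>R z = 2 *\<^sub>R (x - 2 *\<^sub>R ?w)"
      by (simp add: algebra_simps scaleR_2)
    then have "2 * norm (x - 2 *\<^sub>R ?w) \<le> M / 2 ^ n"
      using z(2) by simp
    then have "norm (x - 2 *\<^sub>R ?w) \<le> M / 2 ^ Suc n" by (simp add: field_simps)
    with w show ?case by blast
  qed
  have "x \<in> ?H" if "norm x \<le> 1" for x
  proof -
    have "x \<in> closure ?H"
      unfolding closure_approachable
    proof (intro allI impI)
      fix e :: real assume "e > 0"
      have "(\<lambda>n. M / 2 ^ n) \<longlonglongrightarrow> 0"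
        using tendsto_mult_right_zero[OF LIMSEQ_power_zero[of "1 / 2 :: real"], of M]
        by (simp add: power_divide)
      then have "\<forall>\<^sub>F n in sequentially. M / 2 ^ n < e"
        using \<open>e > 0\<close> order_tendstoD(2) by blast
      then obtain n where "M / 2 ^ n < e"
        using eventually_happens'[OF sequentially_bot] by blast
      with approx[OF that, of n] show "\<exists>y\<in>?H. dist y x < e"
        by (force simp: dist_norm norm_minus_commute)
    qed
    with H show ?thesis by (simp add: closure_closed)
  qed
  then have unit: "x \<in> span F" if "norm x \<le> 1" for x
    using that convex_hull_subset_span[of F] span_scale by blast
  have "x \<in> span F" for x
  proof (cases "x = 0")
    case True
    then show ?thesis by (simp add: span_zero)
  next
    case False
    have "(1 / norm x) *\<^sub>R x \<in> span F"
      using False by (intro unit) simp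
    then have "norm x *\<^sub>R ((1 / norm x) *\<^sub>R x) \<in> span F" by (rule span_scale)
    with False show ?thesis by simp
  qed
  with F(1) that show thesis by blast
qed

text \<open>A ball inside \<open>S\<close> could be translated and rescaled to the unit ball, inside
  a compact image of \<open>S\<close>.\<close>

lemma interior_compact_infinite_dimensional:
  fixes S :: "'a::real_normed_vector set"
  assumes "\<not> (\<exists>B :: 'a set. finite B \<and> span B = UNIV)" and "compact S"
  shows "interior S = {}"
proof (rule ccontr)
  assume "interior S \<noteq> {}"
  then obtain z e where e: "e > 0" "cball z e \<subseteq> S"
    by (meson ex_in_conv mem_interior_cball)
  let ?T = "(\<lambda>x. (1 / e) *\<^sub>R (x - z)) ` S"
  have "compact ?T"
    by (intro compact_continuous_image continuous_intros assms(2))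
  moreover have "cball 0 1 \<subseteq> ?T"
  proof
    fix x :: 'a assume "x \<in> cball 0 1"
    then have "z + e *\<^sub>R x \<in> S"
      using e by (intro subsetD[OF e(2)]) (auto simp: dist_norm)
    moreover have "x = (1 / e) *\<^sub>R ((z + e *\<^sub>R x) - z)" using e by simp
    ultimately show "x \<in> ?T" by blast
  qed
  ultimately show False
    using cball_subset_compact_imp_finite_span assms(1) by metis
qed

section \<open>Complete thinness\<close>

lemma nowhere_dense_in_subset:
  "nowhere_dense_in X N \<Longrightarrow> M \<subseteq> N \<Longrightarrow> nowhere_dense_in X M"
  unfolding nowhere_dense_in_def
  by (metis closure_of_mono interior_of_mono subset_empty subset_trans)

lemma nowhere_dense_maps_meeting_compact:
  fixes A :: "'q::banach set" and K :: "'k topology"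
  assumes inf: "\<not> (\<exists>B :: 'q set. finite B \<and> span B = UNIV)"
    and "compact A" and K: "compact_space K"
  shows "nowhere_dense_in (mtopology_of (C_space K))
           {\<Psi> \<in> mspace (C_space K). \<Psi> ` topspace K \<inter> A \<noteq> {}}" (is "nowhere_dense_in ?X ?N")
proof -
  let ?M = "mspace (C_space K) :: ('k \<Rightarrow> 'q) set"
  let ?d = "mdist (C_space K) :: ('k \<Rightarrow> 'q) \<Rightarrow> _"
  interpret C: Metric_space ?M ?d by (rule Metric_space_mspace_mdist)
  have cK: "compactin K (topspace K)" using K by (simp add: compact_space_def)
  have False if \<Phi>: "\<Phi> \<in> ?X interior_of (?X closure_of ?N)" for \<Phi>
  proof -
    obtain r where r: "\<Phi> \<in> ?M" "r > 0" "C.mball \<Phi> r \<subseteq> C.mtopology closure_of ?N"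
      using \<Phi> unfolding mtopology_of_def C.metric_interior_of by blast
    have cont: "continuous_map K euclidean \<Phi>"
      using r(1) by simp
    \<comment> \<open>\<open>v \<notin> D\<close> says precisely that the translate of
      \<open>\<Phi>\<close> by \<open>v\<close> misses \<open>A\<close> on all of
      \<open>K\<close>.\<close>
    define D where "D = {a - b | a b. a \<in> A \<and> b \<in> \<Phi> ` topspace K}"
    have "compact (\<Phi> ` topspace K)"
      using image_compactin[OF cK cont] by simp
    then have D: "compact D"
      unfolding D_def by (rule compact_differences[OF \<open>compact A\<close>])
    \<comment> \<open>The bound \<open>r / 2\<close> leaves room: the maximum norm is estimated by a
      non-strict inequality, while \<open>C.mball\<close> is open.\<close>
    obtain v where v: "norm v < r / 2" "v \<notin> D"
    proof -
      have "\<not> ball 0 (r / 2) \<subseteq> D"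
        using interior_compact_infinite_dimensional[OF inf D] r(2)
          interior_maximal[of "ball 0 (r / 2)" D] by auto
      then obtain v where "v \<in> ball 0 (r / 2)" "v \<notin> D" by blast
      then show thesis by (intro that[of v]) simp_all
    qed
    \<comment> \<open>As \<open>D\<close> is closed, \<open>\<delta>\<close> measures how far
      \<open>\<Psi>\<close> may be perturbed without meeting \<open>A\<close>: a map
      \<open>\<Psi>'\<close> within \<open>\<delta>\<close> of \<open>\<Psi>\<close> keeps
      \<open>\<Psi>' x - \<Phi> x\<close> in \<open>ball v \<delta>\<close>, off
      \<open>D\<close>.\<close>
    obtain \<delta> where \<delta>: "\<delta> > 0" "ball v \<delta> \<subseteq> - D"
      using v(2) compact_imp_closed[OF D] open_contains_ball[of "- D"] by auto
    \<comment> \<open>The restriction makes \<open>\<Psi>\<close> undefined off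
      \<open>topspace K\<close>, as the points of \<open>C_space K\<close> must be.\<close>
    define \<Psi> where "\<Psi> = restrict (\<lambda>x. \<Phi> x + v) (topspace K)"
    have "continuous_map K euclidean (\<lambda>x. \<Phi> x + v)"
      by (intro continuous_map_add cont continuous_map_const[THEN iffD2]) auto
    then have "continuous_map K euclidean \<Psi>"
      by (rule continuous_map_eq) (simp add: \<Psi>_def)
    then have \<Psi>: "\<Psi> \<in> ?M"
      unfolding compactin_mspace_cfunspace[OF cK] by (simp add: \<Psi>_def)
    have "?d \<Phi> \<Psi> \<le> r / 2"
      using v(1) r(2) by (intro mdist_cfunspace_le) (auto simp: \<Psi>_def dist_norm)
    with r \<Psi> have "\<Psi> \<in> C.mtopology closure_of ?N"
      by (intro subsetD[OF r(3)]) (simp add: C.in_mball del: mspace_cfunspace)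
    then obtain \<Psi>' where \<Psi>': "\<Psi>' \<in> ?N" "\<Psi>' \<in> C.mball \<Psi> \<delta>"
      using \<delta>(1) unfolding C.metric_closure_of by blast
    then obtain x where x: "x \<in> topspace K" "\<Psi>' x \<in> A" by blast
    have "mdist euclidean_metric (\<Psi> x) (\<Psi>' x) < \<delta>"
      using \<Psi>'(2) x(1) unfolding C.in_mball by (blast intro: cfunspace_mdist_lt[OF cK])
    then have "\<Psi>' x - \<Phi> x \<in> ball v \<delta>"
      using x by (simp add: \<Psi>_def dist_norm algebra_simps)
    moreover have "\<Psi>' x - \<Phi> x \<in> D" using x by (auto simp: D_def)
    ultimately show False using \<delta>(2) by blast
  qed
  then show ?thesis unfolding nowhere_dense_in_def by (auto simp del: mspace_cfunspace)
qed

lemma completely_thin_subset_compact: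
  fixes Y :: "'q::banach set"
  assumes "\<not> (\<exists>B :: 'q set. finite B \<and> span B = UNIV)" "compact A" "Y \<subseteq> A"
  shows "completely_thin TYPE('k) Y"
  unfolding completely_thin_def first_category_in_def
proof (intro allI impI)
  fix K :: "'k topology" assume K: "compact_space K"
  let ?N = "{\<Psi> \<in> mspace (C_space K). \<Psi> ` topspace K \<inter> Y \<noteq> {}}"
  have "nowhere_dense_in (mtopology_of (C_space K)) ?N"
    using nowhere_dense_maps_meeting_compact[OF assms(1,2) K]
    by (rule nowhere_dense_in_subset) (use assms(3) in blast)
  \<comment> \<open>The set is itself nowhere dense, so a family with one member suffices.\<close>
  then show "\<exists>\<N>. countable \<N> \<and> (\<forall>N\<in>\<N>. nowhere_dense_in (mtopology_of (C_space K)) N) \<and> ?N = \<Union>\<N>"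
    by (intro exI[of _ "{?N}"]) simp
qed

theorem theorem5:
  fixes K\<^sub>0 K\<^sub>1 :: "'q::banach set"
  assumes infinite_dimensional: "\<not> (\<exists>B :: 'q set. finite B \<and> span B = UNIV)"
    and "compact K\<^sub>0" and "compact K\<^sub>1"
  shows "completely_thin TYPE('k)
           {y :: 'q. \<not> (\<exists>l :: 'q \<Rightarrow>\<^sub>L real.
              \<forall>x\<^sub>0 \<in> K\<^sub>0. \<forall>x\<^sub>1 \<in> (\<lambda>u. u + y) ` K\<^sub>1. blinfun_apply l (x\<^sub>1 - x\<^sub>0) > 0)}"
proof -
  \<comment> \<open>The closed hull serves twice: closed and convex for the separation, compact for
    the thinness.\<close>
  define C where "C = closure (convex hull {a - b | a b. a \<in> K\<^sub>1 \<and> b \<in> K\<^sub>0})"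
  have C: "compact C"
    unfolding C_def using assms
    by (intro Mazur_compact_closure_convex_hull compact_differences)
  have convex: "convex C" unfolding C_def by simp
  have diff: "a - b \<in> C" if "a \<in> K\<^sub>1" "b \<in> K\<^sub>0" for a b
    unfolding C_def using that by (intro closure_subset[THEN subsetD] hull_inc) blast
  have "\<exists>l :: 'q \<Rightarrow>\<^sub>L real. \<forall>x\<^sub>0 \<in> K\<^sub>0. \<forall>x\<^sub>1 \<in> (\<lambda>u. u + y) ` K\<^sub>1. blinfun_apply l (x\<^sub>1 - x\<^sub>0) > 0"
    if "y \<notin> uminus ` C" for y
  proof -
    \<comment> \<open>\<open>y + c = 0\<close> would mean \<open>y = - c\<close>. The set to be
      separated from \<open>0\<close> is the translate \<open>y + C\<close>, which contains every
      \<open>u + y - x\<^sub>0\<close>.\<close>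
    have "0 \<notin> (+) y ` C"
      using that by (force simp: add_eq_0_iff)
    then obtain l :: "'q \<Rightarrow>\<^sub>L real" where l: "\<And>c. c \<in> (+) y ` C \<Longrightarrow> blinfun_apply l c > 0"
      using separation_closed_convex_zero[of "(+) y ` C"] convex C
      by (metis closed_translation compact_imp_closed convex_translation)
    have "blinfun_apply l (u + y - x\<^sub>0) > 0" if "x\<^sub>0 \<in> K\<^sub>0" "u \<in> K\<^sub>1" for x\<^sub>0 u
    proof -
      have "y + (u - x\<^sub>0) \<in> (+) y ` C" using diff that by blast
      then show ?thesis using l by (fastforce simp: algebra_simps)
    qed
    then show ?thesis by blast
  qed
  then show ?thesis
    by (intro completely_thin_subset_compact[OF infinite_dimensional compact_negations[OF C]]) blast
qed

end
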